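(* Let $\mathcal{K}$ be a unital associative algebra over $\mathbb{C}$ (not necessarily commutative) and let $M$ be an $n\times n$ Manin matrix over $\mathcal{K}$. (a) If $M$ can be factorized as $M=X\,\mathrm{diag}(y_1,\dots,y_n)\,Z$, where $X$ is an upper triangular matrix with $1$'s on the diagonal, $Z$ is a lower triangular matrix with $1$'s on the diagonal, and all entries lie in $\mathcal{K}$, then $$\det{}^{col}(M)=y_n\,y_{n-1}\cdots y_1 .$$ (b) If $M$ can be factorized as $M=X'\,\mathrm{diag}(y_1',\dots,y_n')\,Z'$, where $X'$ is a lower triangular matrix with $1$'s on the diagonal, $Z'$ is an upper triangular matrix with $1$'s on the diagonal, and all entries lie in $\mathcal{K}$, then $$\det{}^{col}(M)=y_1'\,y_2'\cdots y_n' .$$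
   Context: A (possibly rectangular) matrix $M=(M_{ij})$ with entries in an associative ring $\mathcal{K}$ is called a Manin matrix if (1) entries lying in the same column commute with each other, and (2) $[M_{ij},M_{kl}]=[M_{kj},M_{il}]$ for all $i,j,k,l$, where $[a,b]=ab-ba$. For any $n\times n$ matrix $X$ over $\mathcal{K}$, $\det^{col}(X)=\sum_{\sigma\in S_n}\operatorname{sgn}(\sigma)\,X_{\sigma(1)1}X_{\sigma(2)2}\cdots X_{\sigma(n)n}$. *)

theory Defs
  imports
    Complex_Main
    "HOL-Combinatorics.Permutations"
    "Jordan_Normal_Form.Matrix"
begin

(* The sort {ring, monoid_mult} is used instead of ring_1 because ring_1 demands 0 \<noteq> 1 and
   would exclude the zero algebra. *)

locale complex_algebra = vector_space scale
  for scale :: "complex \<Rightarrow> 'a::{ring, monoid_mult} \<Rightarrow> 'a" +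
  assumes scale_mult_left: "scale c x * y = scale c (x * y)"
    and scale_mult_right: "x * scale c y = scale c (x * y)"

definition commutator :: "'a::ring \<Rightarrow> 'a \<Rightarrow> 'a" where
  "commutator a b = a * b - b * a"

definition manin_matrix :: "'a::ring mat \<Rightarrow> bool" where
  "manin_matrix M \<longleftrightarrow>
     (\<forall>i < dim_row M. \<forall>k < dim_row M. \<forall>j < dim_col M.
        M $$ (i, j) * M $$ (k, j) = M $$ (k, j) * M $$ (i, j)) \<and>
     (\<forall>i < dim_row M. \<forall>k < dim_row M. \<forall>j < dim_col M. \<forall>l < dim_col M.
        commutator (M $$ (i, j)) (M $$ (k, l)) = commutator (M $$ (k, j)) (M $$ (i, l)))"

(* Meant for square matrices only. The product is a prod_list since the order of the factors
   matters: columns run from left to right. The sign is written as a case distinction on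
   evenperm because of_int is not available without ring_1. *)
definition det_col :: "'a::{ring, monoid_mult} mat \<Rightarrow> 'a" where
  "det_col M = (\<Sum>\<sigma> | \<sigma> permutes {0..<dim_row M}.
     let m = prod_list (map (\<lambda>j. M $$ (\<sigma> j, j)) [0..<dim_row M])
     in if evenperm \<sigma> then m else - m)"

definition lower_triangular :: "'a::zero mat \<Rightarrow> bool" where
  "lower_triangular A \<longleftrightarrow> (\<forall>j < dim_col A. \<forall>i < j. A $$ (i, j) = 0)"

definition unit_diagonal :: "'a::one mat \<Rightarrow> bool" where
  "unit_diagonal A \<longleftrightarrow> (\<forall>i < dim_row A. A $$ (i, i) = 1)"

end

theory Submission
  imports Defs
begin

text \<open>
  In terms of Grassmann variables \<open>\<psi>\<close>, the Manin property says that the elements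
  \<open>\<Psi> j = (\<Sum>i. \<psi> i * M i j)\<close> anticommute, and the column determinant is the coefficient of
  \<open>\<Psi> 1 \<cdots> \<Psi> n\<close>; hence it is alternating in the columns. The last column is the rightmost
  factor, so the determinant is also right linear in it. If \<open>M = X D Z\<close> with \<open>X\<close> lower and \<open>Z\<close>
  upper unitriangular, column \<open>k\<close> of \<open>M\<close> is column \<open>k\<close> of \<open>X D\<close> plus right multiples of the earlier
  columns of \<open>X D\<close>. Thus, in the determinant, the last column of \<open>M\<close> may be replaced by the last
  column of \<open>X D\<close>, which has the single nonzero entry \<open>y n\<close>, and induction on \<open>n\<close> gives (b). No
  invertibility of the \<open>y i\<close> is needed. Part (a) is (b) with the rows and columns reversed.
\<close>

section \<open>Signs, column determinants and the Manin property for index functions\<close>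

definition signed :: "(nat \<Rightarrow> nat) \<Rightarrow> 'a::ring \<Rightarrow> 'a" where
  "signed p x = (if evenperm p then x else - x)"

text \<open>Entries form a function with the size kept apart, so permuting columns is composition,
  and a leading block has the same \<open>f\<close> with a smaller \<open>n\<close>.\<close>

definition column_det :: "nat \<Rightarrow> (nat \<Rightarrow> nat \<Rightarrow> 'a::{ring, monoid_mult}) \<Rightarrow> 'a" where
  "column_det n f = (\<Sum>p | p permutes {0..<n}. signed p (prod_list (map (\<lambda>j. f (p j) j) [0..<n])))"

definition manin :: "nat \<Rightarrow> (nat \<Rightarrow> nat \<Rightarrow> 'a::ring) \<Rightarrow> bool" where
  "manin n f \<longleftrightarrow>
     (\<forall>i<n. \<forall>k<n. \<forall>j<n. f i j * f k j = f k j * f i j) \<and>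
     (\<forall>i<n. \<forall>k<n. \<forall>j<n. \<forall>l<n. commutator (f i j) (f k l) = commutator (f k j) (f i l))"

lemma signed_mult_right: "signed p x * y = signed p (x * y)"
  by (simp add: signed_def)

lemma signed_add: "signed p (x + y) = signed p x + signed p y"
  by (simp add: signed_def)

lemma signed_sum: "signed p (sum f A) = (\<Sum>a\<in>A. signed p (f a))"
  by (simp add: signed_def sum_negf)

lemma signed_signed [simp]: "signed p (signed p x) = x"
  by (simp add: signed_def)

lemma signed_compose:
  assumes "p permutes {0..<n}" "q permutes {0..<n}"
  shows "signed (p \<circ> q) x = signed p (signed q x)"
proof -
  have "permutation p" "permutation q"
    using assms by (auto simp: permutation_permutes)
  then show ?thesis
    by (auto simp: signed_def evenperm_comp)
qed

lemma signed_transpose: "a \<noteq> b \<Longrightarrow> signed (transpose a b) x = - x"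
  by (simp add: signed_def evenperm_swap)

lemma column_det_cong:
  assumes "\<And>i j. i < n \<Longrightarrow> j < n \<Longrightarrow> f i j = g i j"
  shows "column_det n f = column_det n g"
  unfolding column_det_def
proof (rule sum.cong[OF refl])
  fix p assume "p \<in> {p. p permutes {0..<n}}"
  then have "p j < n" if "j < n" for j
    using that permutes_in_image[of p "{0..<n}" j] by simp
  then have "map (\<lambda>j. f (p j) j) [0..<n] = map (\<lambda>j. g (p j) j) [0..<n]"
    using assms by simp
  then show "signed p (prod_list (map (\<lambda>j. f (p j) j) [0..<n])) =
      signed p (prod_list (map (\<lambda>j. g (p j) j) [0..<n]))"
    by (rule arg_cong)
qed

text \<open>Factors are ordered by column, so acting on rows only reindexes the sum by
  \<open>q \<circ> p\<close> and leaves each product in order.\<close>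

lemma column_det_permute_rows:
  assumes "q permutes {0..<n}"
  shows "column_det n (\<lambda>i j. f (q i) j) = signed q (column_det n f)"
proof -
  have "signed q (column_det n f) = (\<Sum>p | p permutes {0..<n}.
      signed q (signed (q \<circ> p) (prod_list (map (\<lambda>j. f ((q \<circ> p) j) j) [0..<n]))))"
    unfolding column_det_def signed_sum
    by (rule setum_permutations_compose_left[OF assms])
  also have "\<dots> = column_det n (\<lambda>i j. f (q i) j)"
    unfolding column_det_def
    by (rule sum.cong) (simp_all add: signed_compose[OF assms])
  finally show ?thesis by simp
qed

section \<open>Column permutations of a Manin matrix\<close>

lemma manin_columns:
  assumes "manin n f" "\<And>j. j < n \<Longrightarrow> c j < n"
  shows "manin n (\<lambda>i j. f i (c j))"
  using assms unfolding manin_def by simp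

lemma manin_rows:
  assumes "manin n f" "\<And>i. i < n \<Longrightarrow> c i < n"
  shows "manin n (\<lambda>i j. f (c i) j)"
  using assms unfolding manin_def by simp

lemma upt_split_pair:
  assumes "Suc r < n"
  shows "[0..<n] = [0..<r] @ [r, Suc r] @ [Suc (Suc r)..<n]"
proof -
  have "[0..<n] = [0..<r] @ [r..<n]"
    using assms upt_add_eq_append[of 0 r "n - r"] by simp
  also have "[r..<n] = [r, Suc r] @ [Suc (Suc r)..<n]"
    using assms by (simp add: upt_conv_Cons)
  finally show ?thesis .
qed

text \<open>In the sum of both determinants, the two adjacent columns contribute a factor symmetric
  in the two rows involved, while exchanging these rows flips the sign.\<close>

lemma column_det_swap_adjacent:
  fixes f :: "nat \<Rightarrow> nat \<Rightarrow> 'a::{ring, monoid_mult}"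
  assumes torsion: "\<forall>x::'a. x + x = 0 \<longrightarrow> x = 0"
    and f: "manin n f" and r: "Suc r < n"
  shows "column_det n (\<lambda>i j. f i (transpose r (Suc r) j)) = - column_det n f"
proof -
  define s where "s = transpose r (Suc r)"
  have s: "s permutes {0..<n}"
    unfolding s_def using r by (intro permutes_swap_id) auto
  define A where "A p = prod_list (map (\<lambda>j. f (p j) j) [0..<r])" for p :: "nat \<Rightarrow> nat"
  define B where "B p = prod_list (map (\<lambda>j. f (p j) j) [Suc (Suc r)..<n])" for p :: "nat \<Rightarrow> nat"
  define T where "T p = A p * (f (p r) r * f (p (Suc r)) (Suc r) +
      f (p r) (Suc r) * f (p (Suc r)) r) * B p" for p :: "nat \<Rightarrow> nat"
  have split: "prod_list (map (\<lambda>j. f (p j) j) [0..<n]) =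
      A p * (f (p r) r * f (p (Suc r)) (Suc r)) * B p" for p
    unfolding upt_split_pair[OF r] A_def B_def by (simp add: mult.assoc)
  have split': "prod_list (map (\<lambda>j. f (p j) (s j)) [0..<n]) =
      A p * (f (p r) (Suc r) * f (p (Suc r)) r) * B p" for p
  proof -
    have "map (\<lambda>j. f (p j) (s j)) [0..<r] = map (\<lambda>j. f (p j) j) [0..<r]"
      "map (\<lambda>j. f (p j) (s j)) [Suc (Suc r)..<n] = map (\<lambda>j. f (p j) j) [Suc (Suc r)..<n]"
      by (auto simp: s_def transpose_def)
    moreover have "s r = Suc r" "s (Suc r) = r"
      by (simp_all add: s_def)
    ultimately show ?thesis
      unfolding upt_split_pair[OF r] A_def B_def by (simp add: mult.assoc del: map_eq_conv)
  qed
  have T: "column_det n f + column_det n (\<lambda>i j. f i (s j)) =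
      (\<Sum>p | p permutes {0..<n}. signed p (T p))"
    unfolding column_det_def split split' T_def
    by (simp add: sum.distrib[symmetric] signed_add[symmetric] distrib_left distrib_right)
  have T_s: "T (p \<circ> s) = T p" if p: "p permutes {0..<n}" for p
  proof -
    have AB: "A (p \<circ> s) = A p" "B (p \<circ> s) = B p"
      unfolding A_def B_def by (auto intro!: arg_cong[of _ _ prod_list] simp: s_def transpose_def)
    have sr: "(p \<circ> s) r = p (Suc r)" "(p \<circ> s) (Suc r) = p r"
      by (simp_all add: s_def)
    have "p r < n" "p (Suc r) < n"
      using permutes_in_image[OF p] r by auto
    \<comment> \<open>Moving the negative terms of this cross relation to the other side gives the
      symmetry of the middle factor of \<open>T p\<close> in the rows \<open>p r\<close> and
      \<open>p (Suc r)\<close>.\<close>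
    then have "commutator (f (p r) r) (f (p (Suc r)) (Suc r)) =
        commutator (f (p (Suc r)) r) (f (p r) (Suc r))"
      using f r unfolding manin_def by simp
    then have "f (p (Suc r)) r * f (p r) (Suc r) + f (p (Suc r)) (Suc r) * f (p r) r =
        f (p r) r * f (p (Suc r)) (Suc r) + f (p r) (Suc r) * f (p (Suc r)) r"
      unfolding commutator_def by (simp add: algebra_simps)
    then show ?thesis
      unfolding T_def AB sr by simp
  qed
  \<comment> \<open>Reindexing by \<open>p \<circ> s\<close> shows that the sum is its own negative;
    \<open>torsion\<close> then makes it vanish.\<close>
  have "(\<Sum>p | p permutes {0..<n}. signed p (T p)) =
      (\<Sum>p | p permutes {0..<n}. signed (p \<circ> s) (T (p \<circ> s)))"
    by (rule sum_permutations_compose_right[OF s])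
  also have "\<dots> = (\<Sum>p | p permutes {0..<n}. - signed p (T p))"
  proof (rule sum.cong[OF refl])
    fix p assume "p \<in> {p. p permutes {0..<n}}"
    then have p: "p permutes {0..<n}" by simp
    show "signed (p \<circ> s) (T (p \<circ> s)) = - signed p (T p)"
      unfolding signed_compose[OF p s] T_s[OF p]
      by (simp add: s_def signed_transpose) (simp add: signed_def)
  qed
  finally have "(\<Sum>p | p permutes {0..<n}. signed p (T p)) +
      (\<Sum>p | p permutes {0..<n}. signed p (T p)) = 0"
    unfolding sum_negf eq_neg_iff_add_eq_0 .
  then have "(\<Sum>p | p permutes {0..<n}. signed p (T p)) = 0"
    by (rule torsion[rule_format])
  then show ?thesis
    using T unfolding s_def by (simp add: add_eq_0_iff)
qed

text \<open>With \<open>b = Suc r\<close>, conjugating the transposition of \<open>a\<close> and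
  \<open>r\<close> by that of \<open>r\<close> and \<open>b\<close> gives the transposition of
  \<open>a\<close> and \<open>b\<close>: three sign changes amount to one. The induction generalizes
  \<open>f\<close> because its hypothesis is applied to a matrix with columns already
  swapped.\<close>

lemma column_det_swap:
  fixes f :: "nat \<Rightarrow> nat \<Rightarrow> 'a::{ring, monoid_mult}"
  assumes torsion: "\<forall>x::'a. x + x = 0 \<longrightarrow> x = 0"
    and "manin n f" "a < b" "b < n"
  shows "column_det n (\<lambda>i j. f i (transpose a b j)) = - column_det n f"
  using assms(2-)
proof (induction "b - a" arbitrary: b f)
  case 0
  then show ?case by simp
next
  case (Suc d)
  then obtain r where b: "b = Suc r" by (cases b) auto
  show ?case
  proof (cases "a = r")
    case True
    then show ?thesis
      using column_det_swap_adjacent[OF torsion] Suc.prems b by simp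
  next
    case False
    define s where "s = transpose r (Suc r)"
    have lt: "a < r" "r < n" "Suc r < n" "d = r - a"
      using False Suc b by auto
    have sn: "s j < n" "transpose a r j < n" if "j < n" for j
      using that lt by (auto simp: s_def transpose_def)
    have "transpose a b = s \<circ> transpose a r \<circ> s"
      unfolding s_def b using lt by (auto simp: transpose_def fun_eq_iff)
    then have "column_det n (\<lambda>i j. f i (transpose a b j)) =
        column_det n (\<lambda>i j. f i (s (transpose a r (s j))))"
      by simp
    also have "\<dots> = - column_det n (\<lambda>i j. f i (s (transpose a r j)))"
    proof -
      have "manin n (\<lambda>i j. f i (s (transpose a r j)))"
        by (rule manin_columns[OF Suc.prems(1)]) (simp add: sn)
      from column_det_swap_adjacent[OF torsion this lt(3)] show ?thesis
        by (simp add: s_def)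
    qed
    also have "column_det n (\<lambda>i j. f i (s (transpose a r j))) = - column_det n (\<lambda>i j. f i (s j))"
      using Suc.hyps(1)[OF lt(4) manin_columns[OF Suc.prems(1)] lt(1,2), of s] sn by simp
    also have "column_det n (\<lambda>i j. f i (s j)) = - column_det n f"
      unfolding s_def by (rule column_det_swap_adjacent[OF torsion Suc.prems(1) lt(3)])
    finally show ?thesis by simp
  qed
qed

text \<open>Decomposing \<open>q\<close> into transpositions reduces this to
  \<open>column_det_swap\<close>; it serves to reverse the columns in the upper-lower case.\<close>

lemma column_det_permute_columns:
  fixes f :: "nat \<Rightarrow> nat \<Rightarrow> 'a::{ring, monoid_mult}"
  assumes torsion: "\<forall>x::'a. x + x = 0 \<longrightarrow> x = 0"
    and f: "manin n f" and q: "q permutes {0..<n}"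
  shows "column_det n (\<lambda>i j. f i (q j)) = signed q (column_det n f)"
proof -
  have "finite {0..<n}" by simp
  from q this f show ?thesis
  proof (induction arbitrary: f rule: permutes_induct)
    case id
    then show ?case by (simp add: signed_def)
  next
    case (swap a b p)
    have t: "transpose a b permutes {0..<n}"
      using swap by (intro permutes_swap_id) auto
    have tn: "transpose a b j < n" if "j < n" for j
      using that swap by (auto simp: transpose_def)
    have "column_det n (\<lambda>i j. f i (transpose a b (p j))) =
        signed p (column_det n (\<lambda>i j. f i (transpose a b j)))"
      by (rule swap.IH[OF manin_columns[OF swap.prems tn]])
    also have "column_det n (\<lambda>i j. f i (transpose a b j)) = - column_det n f"
      using column_det_swap[OF torsion swap.prems, of a b]
        column_det_swap[OF torsion swap.prems, of b a] swap.hyps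
      by (cases "a < b") (auto simp: transpose_commute)
    also have "signed p (- column_det n f) = signed (transpose a b \<circ> p) (column_det n f)"
      unfolding signed_compose[OF t swap.hyps(4)] using swap.hyps
      by (simp add: signed_transpose) (simp add: signed_def)
    finally show ?case by (simp only: o_def)
  qed
qed

text \<open>Swapping the two equal columns fixes the matrix but negates its determinant.\<close>

lemma column_det_repeated_column:
  fixes f :: "nat \<Rightarrow> nat \<Rightarrow> 'a::{ring, monoid_mult}"
  assumes torsion: "\<forall>x::'a. x + x = 0 \<longrightarrow> x = 0"
    and f: "manin n f" and "a < b" "b < n" and eq: "\<And>i. f i a = f i b"
  shows "column_det n f = 0"
proof -
  have "(\<lambda>i j. f i (transpose a b j)) = f"
    using eq by (auto simp: transpose_def fun_eq_iff)
  then have "column_det n f = - column_det n f"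
    using column_det_swap[OF torsion f assms(3,4)] by simp
  then show ?thesis
    unfolding eq_neg_iff_add_eq_0 by (rule torsion[rule_format])
qed

section \<open>The determinant of size \<open>Suc n\<close> as a function of its last column\<close>

definition last_column_det ::
    "nat \<Rightarrow> (nat \<Rightarrow> nat \<Rightarrow> 'a::{ring, monoid_mult}) \<Rightarrow> (nat \<Rightarrow> 'a) \<Rightarrow> 'a" where
  "last_column_det n f v = column_det (Suc n) (\<lambda>i j. if j = n then v i else f i j)"

text \<open>Column \<open>n\<close> supplies the rightmost factor, which splits off from the signed
  product of the others.\<close>

lemma last_column_det_altdef:
  "last_column_det n f v =
     (\<Sum>p | p permutes {0..<Suc n}. signed p (prod_list (map (\<lambda>j. f (p j) j) [0..<n])) * v (p n))"
proof -
  have "map (\<lambda>j. if j = n then v (p j) else f (p j) j) [0..<n] = map (\<lambda>j. f (p j) j) [0..<n]" for p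
    by simp
  then show ?thesis
    unfolding last_column_det_def column_det_def
    by (simp add: signed_mult_right del: map_eq_conv)
qed

lemma last_column_det_cong:
  assumes "\<And>i. i \<le> n \<Longrightarrow> v i = w i"
  shows "last_column_det n f v = last_column_det n f w"
  unfolding last_column_det_def by (rule column_det_cong) (simp add: assms)

text \<open>Since the entry of the last column is the rightmost factor, right coefficients pass out
  of every term.\<close>

lemma last_column_det_sum:
  "last_column_det n f (\<lambda>i. \<Sum>k\<in>K. v k i * c k) = (\<Sum>k\<in>K. last_column_det n f (v k) * c k)"
proof -
  have "last_column_det n f (\<lambda>i. \<Sum>k\<in>K. v k i * c k) = (\<Sum>p | p permutes {0..<Suc n}. \<Sum>k\<in>K.
      signed p (prod_list (map (\<lambda>j. f (p j) j) [0..<n])) * (v k (p n)) * c k)"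
    unfolding last_column_det_altdef by (simp only: sum_distrib_left mult.assoc)
  also have "\<dots> = (\<Sum>k\<in>K. last_column_det n f (v k) * c k)"
    unfolding last_column_det_altdef by (subst sum.swap) (simp only: sum_distrib_right)
  finally show ?thesis .
qed

lemma permutes_Suc_fixing_last:
  "{p. p permutes {0..<Suc n} \<and> p n = n} = {p. p permutes {0..<n}}"
proof (intro equalityI subsetI CollectI; elim CollectE conjE)
  fix p assume p: "p permutes {0..<Suc n}" "p n = n"
  show "p permutes {0..<n}"
    by (rule permutes_superset[OF p(1)]) (use p(2) in \<open>auto simp: less_Suc_eq\<close>)
next
  fix p assume p: "p permutes {0..<n}"
  show "p permutes {0..<Suc n} \<and> p n = n"
    using permutes_subset[OF p, of "{0..<Suc n}"] permutes_not_in[OF p, of n] by auto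
qed

text \<open>Only permutations fixing \<open>n\<close> survive. They are the permutations of the
  first \<open>n\<close> indices, with the same sign because \<open>evenperm\<close> does not refer
  to an ambient set.\<close>

lemma last_column_det_unit:
  "last_column_det n f (\<lambda>i. if i = n then c else 0) = column_det n f * c"
proof -
  have "last_column_det n f (\<lambda>i. if i = n then c else 0) =
      (\<Sum>p | p permutes {0..<Suc n} \<and> p n = n.
        signed p (prod_list (map (\<lambda>j. f (p j) j) [0..<n])) * c)"
    unfolding last_column_det_altdef
    by (rule sum.mono_neutral_cong_right) (auto simp: finite_permutations)
  also have "\<dots> = column_det n f * c"
    unfolding permutes_Suc_fixing_last column_det_def by (simp add: sum_distrib_right)
  finally show ?thesis .
qed

section \<open>Determinants from triangular factorizations\<close>

lemma column_det_lower_diag_upper: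
  fixes f x z :: "nat \<Rightarrow> nat \<Rightarrow> 'a::{ring, monoid_mult}"
  assumes torsion: "\<forall>x::'a. x + x = 0 \<longrightarrow> x = 0"
    and "manin n f"
    and "\<And>i j. i < n \<Longrightarrow> j < n \<Longrightarrow> f i j = (\<Sum>k<n. x i k * y k * z k j)"
    and "\<And>i j. i < j \<Longrightarrow> j < n \<Longrightarrow> x i j = 0" "\<And>i. i < n \<Longrightarrow> x i i = 1"
    and "\<And>i j. j < i \<Longrightarrow> i < n \<Longrightarrow> z i j = 0" "\<And>i. i < n \<Longrightarrow> z i i = 1"
  shows "column_det n f = prod_list (map y [0..<n])"
  using assms(2-)
proof (induction n)
  case 0
  then show ?case by (simp add: column_det_def signed_def)
next
  case (Suc n)
  \<comment> \<open>\<open>?L\<close> keeps the first \<open>n\<close> columns of \<open>f\<close>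
    and varies the last; \<open>?u k\<close> is column \<open>k\<close> of the product of
    \<open>x\<close> and the diagonal.\<close>
  let ?L = "last_column_det n f"
  let ?u = "\<lambda>k i. x i k * y k"
  \<comment> \<open>Column \<open>j\<close> of \<open>f\<close> is a right combination of the
    \<open>?u k\<close>; triangularity of \<open>z\<close> stops it at \<open>k = j\<close>, where
    the coefficient is 1.\<close>
  have f_col: "?L (\<lambda>i. f i j) = (\<Sum>k<j. ?L (?u k) * z k j) + ?L (?u j)" if j: "j \<le> n" for j
  proof -
    have "?L (\<lambda>i. f i j) = ?L (\<lambda>i. \<Sum>k<Suc n. ?u k i * z k j)"
      using Suc.prems(2) j by (intro last_column_det_cong) simp
    also have "\<dots> = (\<Sum>k<Suc n. ?L (?u k) * z k j)"
      by (rule last_column_det_sum)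
    also have "\<dots> = (\<Sum>k<Suc j. ?L (?u k) * z k j)"
      using j Suc.prems(5) by (intro sum.mono_neutral_right) auto
    finally show ?thesis
      using Suc.prems(6) j by simp
  qed
  have repeated: "?L (\<lambda>i. f i k) = 0" if k: "k < n" for k
  proof -
    \<comment> \<open>\<open>c\<close> copies column \<open>k\<close> into position
      \<open>n\<close>; \<open>manin_columns\<close> covers such a non-injective map.\<close>
    define c where "c j = (if j = n then k else j)" for j
    have "manin (Suc n) (\<lambda>i j. f i (c j))"
      by (rule manin_columns[OF Suc.prems(1)]) (use k in \<open>auto simp: c_def\<close>)
    then have "column_det (Suc n) (\<lambda>i j. f i (c j)) = 0"
      by (rule column_det_repeated_column[OF torsion _ k]) (auto simp: c_def)
    moreover have "(\<lambda>i j. f i (c j)) = (\<lambda>i j. if j = n then f i k else f i j)"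
      by (auto simp: c_def fun_eq_iff)
    ultimately show ?thesis
      unfolding last_column_det_def by simp
  qed
  \<comment> \<open>A unitriangular system is solved by strong induction: in \<open>f_col\<close>
    the left side vanishes by \<open>repeated\<close> and the earlier terms by induction.\<close>
  have u: "?L (?u k) = 0" if "k < n" for k
    using that
  proof (induction k rule: less_induct)
    case (less k)
    then show ?case
      using f_col[of k] repeated[of k] by simp
  qed
  have "(\<lambda>i j. if j = n then f i n else f i j) = f"
    by (auto simp: fun_eq_iff)
  then have "column_det (Suc n) f = ?L (\<lambda>i. f i n)"
    unfolding last_column_det_def by simp
  also have "\<dots> = ?L (?u n)"
    using f_col[of n] u by simp
  \<comment> \<open>Among rows up to \<open>n\<close>, column \<open>n\<close> of \<open>x\<close>
    has a single nonzero candidate, the 1 on the diagonal.\<close>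
  also have "\<dots> = ?L (\<lambda>i. if i = n then y n else 0)"
    using Suc.prems(3,4) by (intro last_column_det_cong) auto
  also have "\<dots> = column_det n f * y n"
    by (rule last_column_det_unit)
  also have "column_det n f = prod_list (map y [0..<n])"
  proof (rule Suc.IH)
    show "manin n f"
      using Suc.prems(1) unfolding manin_def by simp
    \<comment> \<open>The leading block inherits the factorization: the term \<open>k = n\<close>
      drops out because \<open>z n j = 0\<close> for \<open>j < n\<close>.\<close>
    show "f i j = (\<Sum>k<n. x i k * y k * z k j)" if "i < n" "j < n" for i j
      using that Suc.prems(2)[of i j] Suc.prems(5)[of j n] by simp
  qed (use Suc.prems in auto)
  finally show ?case by simp
qed

text \<open>Reversing all indices exchanges upper and lower triangular and reverses the order of the
  \<open>y k\<close>; the signs from rows and columns cancel.\<close>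

lemma column_det_upper_diag_lower:
  fixes f x z :: "nat \<Rightarrow> nat \<Rightarrow> 'a::{ring, monoid_mult}"
  assumes torsion: "\<forall>x::'a. x + x = 0 \<longrightarrow> x = 0"
    and f: "manin n f"
    and fact: "\<And>i j. i < n \<Longrightarrow> j < n \<Longrightarrow> f i j = (\<Sum>k<n. x i k * y k * z k j)"
    and x: "\<And>i j. j < i \<Longrightarrow> i < n \<Longrightarrow> x i j = 0" "\<And>i. i < n \<Longrightarrow> x i i = 1"
    and z: "\<And>i j. i < j \<Longrightarrow> j < n \<Longrightarrow> z i j = 0" "\<And>i. i < n \<Longrightarrow> z i i = 1"
  shows "column_det n f = prod_list (map y (rev [0..<n]))"
proof -
  define q where "q i = (if i < n then n - Suc i else i)" for i
  have q_less: "q i < n" if "i < n" for i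
    using that by (auto simp: q_def)
  have q_q: "q (q i) = i" for i
    by (auto simp: q_def)
  have q: "q permutes {0..<n}"
    by (rule bij_imp_permutes) (auto intro!: bij_betwI[of _ _ _ q] simp: q_less q_q, simp add: q_def)
  have bij: "bij_betw q {..<n} {..<n}"
    by (rule bij_betwI[of _ _ _ q]) (auto simp: q_less q_q)
  \<comment> \<open>One of the two signs is absorbed by reversing the columns, the other by
    reversing the rows.\<close>
  have "column_det n f = signed q (signed q (column_det n f))"
    by simp
  also have "\<dots> = signed q (column_det n (\<lambda>i j. f i (q j)))"
    using column_det_permute_columns[OF torsion f q] by simp
  also have "\<dots> = column_det n (\<lambda>i j. f (q i) (q j))"
    using column_det_permute_rows[OF q, of "\<lambda>i j. f i (q j)"] by simp
  also have "\<dots> = prod_list (map (\<lambda>k. y (q k)) [0..<n])"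
  proof (rule column_det_lower_diag_upper[OF torsion, where x = "\<lambda>i j. x (q i) (q j)"
        and z = "\<lambda>i j. z (q i) (q j)"])
    show "manin n (\<lambda>i j. f (q i) (q j))"
      by (rule manin_rows[OF manin_columns[OF f]]) (simp_all add: q_less)
    show "f (q i) (q j) = (\<Sum>k<n. x (q i) (q k) * y (q k) * z (q k) (q j))" if "i < n" "j < n" for i j
      using fact[OF q_less q_less, OF that]
        sum.reindex_bij_betw[OF bij, of "\<lambda>k. x (q i) k * y k * z k (q j)"] by simp
  qed (use x z in \<open>auto simp: q_def\<close>)
  also have "map (\<lambda>k. y (q k)) [0..<n] = map y (rev [0..<n])"
    by (rule nth_equalityI) (auto simp: rev_nth q_def)
  finally show ?thesis .
qed

section \<open>Passage to matrices over a complex algebra\<close>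

lemma (in complex_algebra) add_self_eq_0D:
  assumes "(x::'a) + x = 0"
  shows "x = 0"
proof -
  \<comment> \<open>Halving by a complex scalar is what supplies the \<open>torsion\<close>
    assumption of the determinant lemmas.\<close>
  have "x = scale (1/2) x + scale (1/2) x"
    by (simp flip: scale_left_distrib)
  also have "\<dots> = scale (1/2) (x + x)"
    by (simp add: scale_right_distrib)
  finally show ?thesis
    by (simp add: assms)
qed

lemma det_col_eq_column_det:
  assumes "M \<in> carrier_mat n n"
  shows "det_col M = column_det n (\<lambda>i j. M $$ (i, j))"
  using assms by (simp add: det_col_def column_det_def signed_def Let_def)

lemma manin_matrix_imp_manin:
  assumes "M \<in> carrier_mat n n" "manin_matrix M"
  shows "manin n (\<lambda>i j. M $$ (i, j))"
  using assms by (simp add: manin_matrix_def manin_def)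

lemma index_mult_diag_mult:
  fixes X Z :: "'a::semiring_0 mat"
  assumes "X \<in> carrier_mat n n" "Z \<in> carrier_mat n n" "i < n" "j < n"
  shows "(X * mat_diag n y * Z) $$ (i, j) = (\<Sum>k<n. X $$ (i, k) * y k * Z $$ (k, j))"
proof -
  have "X * mat_diag n y = mat n n (\<lambda>(i, k). X $$ (i, k) * y k)"
    using assms(1) by (rule mat_diag_mult_right)
  then show ?thesis
    using assms by (simp add: scalar_prod_def atLeast0LessThan)
qed

theorem proposition16:
  fixes scale :: "complex \<Rightarrow> 'a::{ring, monoid_mult} \<Rightarrow> 'a"
    and M :: "'a mat"
    and n :: nat
  assumes "complex_algebra scale"
    and "M \<in> carrier_mat n n"
    and "manin_matrix M"
  shows "(\<forall>X \<in> carrier_mat n n. \<forall>Z \<in> carrier_mat n n. \<forall>y :: nat \<Rightarrow> 'a.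
            upper_triangular X \<and> unit_diagonal X \<and>
            lower_triangular Z \<and> unit_diagonal Z \<and>
            M = X * mat_diag n y * Z \<longrightarrow>
            det_col M = prod_list (map y (rev [0..<n]))) \<and>
         (\<forall>X' \<in> carrier_mat n n. \<forall>Z' \<in> carrier_mat n n. \<forall>y' :: nat \<Rightarrow> 'a.
            lower_triangular X' \<and> unit_diagonal X' \<and>
            upper_triangular Z' \<and> unit_diagonal Z' \<and>
            M = X' * mat_diag n y' * Z' \<longrightarrow>
            det_col M = prod_list (map y' [0..<n]))"
proof -
  interpret complex_algebra scale by fact
  have torsion: "\<forall>x::'a. x + x = 0 \<longrightarrow> x = 0"
    using add_self_eq_0D by blast
  note M = assms(2) and manin = manin_matrix_imp_manin[OF assms(2,3)]
  note det = det_col_eq_column_det[OF M]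
  show ?thesis
  proof (intro conjI ballI allI impI; elim conjE)
    fix X Z :: "'a mat" and y :: "nat \<Rightarrow> 'a"
    assume carrier: "X \<in> carrier_mat n n" "Z \<in> carrier_mat n n"
      and tri: "upper_triangular X" "unit_diagonal X" "lower_triangular Z" "unit_diagonal Z"
      and M_eq: "M = X * mat_diag n y * Z"
    show "det_col M = prod_list (map y (rev [0..<n]))"
      unfolding det
    proof (rule column_det_upper_diag_lower[OF torsion manin,
          where x = "\<lambda>i j. X $$ (i, j)" and z = "\<lambda>i j. Z $$ (i, j)"])
      show "M $$ (i, j) = (\<Sum>k<n. X $$ (i, k) * y k * Z $$ (k, j))" if "i < n" "j < n" for i j
        unfolding M_eq using carrier that by (rule index_mult_diag_mult)
    qed (use carrier tri in \<open>auto simp: lower_triangular_def unit_diagonal_def\<close>)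
  next
    fix X Z :: "'a mat" and y :: "nat \<Rightarrow> 'a"
    assume carrier: "X \<in> carrier_mat n n" "Z \<in> carrier_mat n n"
      and tri: "lower_triangular X" "unit_diagonal X" "upper_triangular Z" "unit_diagonal Z"
      and M_eq: "M = X * mat_diag n y * Z"
    show "det_col M = prod_list (map y [0..<n])"
      unfolding det
    proof (rule column_det_lower_diag_upper[OF torsion manin,
          where x = "\<lambda>i j. X $$ (i, j)" and z = "\<lambda>i j. Z $$ (i, j)"])
      show "M $$ (i, j) = (\<Sum>k<n. X $$ (i, k) * y k * Z $$ (k, j))" if "i < n" "j < n" for i j
        unfolding M_eq using carrier that by (rule index_mult_diag_mult)
    qed (use carrier tri in \<open>auto simp: lower_triangular_def unit_diagonal_def\<close>)
  qed
qed

end
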